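(* Let $(X,d)$ be a metric space, $Y$ a real vector space, $K\subset Y$ a convex cone, $H\subset K$ a nonempty $K$-convex set with $0\notin \mathrm{vcl}(H+K)$, $f:X\to 2^Y$ a set-valued map, $x_0\in X$, $\epsilon>0$ and $\lambda>0$. Suppose that the following conditions are satisfied: (i) $(X,d)$ is $(f,K)$-lower complete; (ii) $f(x_0)\not\subset f(X)+\epsilon H+K$; (iii) $f$ is $K$-slm and has $K_H$-$v_0$-closed values, where $v_0$ is a certain point in $H+K$. Then there exists $\bar x\in X$ such that (a) $f(x_0)\subset f(\bar x)+(\epsilon/\lambda)d(x_0,\bar x)H+K$; (b) $f(\bar x)\not\subset f(x)+(\epsilon/\lambda)d(\bar x,x)H+K$ for all $x\in X\setminus\{\bar x\}$; (c) $d(x_0,\bar x)\le\lambda$.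
   Context: $2^Y$ is the family of all subsets of $Y$; for $A\subset X$, $f(A)=\bigcup_{x\in A}f(x)$. For $A,B\subset Y$ and $\alpha\in\mathbb R$, $A+B=\{a+b:a\in A,b\in B\}$ and $\alpha A=\{\alpha a:a\in A\}$. A cone is a nonempty set $K\subset Y$ with $\alpha K\subset K$ for all $\alpha\ge 0$; it is a convex cone if also $K+K\subset K$. Cones are always assumed nontrivial: $K\ne\{0\}$ and $K\ne Y$. A set $H$ is $K$-convex if $H+K$ is convex. For nonempty $A\subset Y$, the vector closure is $\mathrm{vcl}(A)=\{y\in Y:\exists v\in Y,\ \exists \lambda_n\ge 0,\ \lambda_n\to 0 \text{ with } y+\lambda_n v\in A\ \forall n\in\mathbb N\}$; for $v_0\in Y$, $\mathrm{vcl}_{v_0}(A)=\{y\in Y:\exists\lambda_n\ge 0,\ \lambda_n\to 0\text{ with }y+\lambda_n v_0\in A\ \forall n\in\mathbb N\}$, and $A$ is $v_0$-closed if $A=\mathrm{vcl}_{v_0}(A)$. $(X,d)$ is $(f,K)$-lower complete if every Cauchy sequence $(x_n)\subset X$ with $f(x_n)\subset f(x_{n+1})+K$ for all $n$ converges to some point of $X$. $f$ is $K$-slm ($K$-sequentially lower monotone) if for any sequence $(x_n)\subset X$ with $x_n\to\bar x\in X$ and $f(x_n)\subset f(x_{n+1})+K$ for all $n$, one has $f(x_n)\subset f(\bar x)+K$ for all $n$. $f$ has $K_H$-$v_0$-closed values if for any $x\in X$ and any $\alpha>0$, $f(x)+\alpha H+K$ is $v_0$-closed. *)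

theory Defs
  imports "HOL-Analysis.Analysis"
begin

text \<open>
  The metric space is the universe of a type of class \<open>metric_space\<close>, the linear space \<open>Y\<close> is the
  universe of a type of class \<open>real_vector\<close> (no topology on \<open>Y\<close>). Sums of sets are those of
  \<open>HOL-Library.Set_Algebras\<close>, and \<open>scaleR \<alpha> ` A\<close> is the dilation \<open>\<alpha>A\<close>; in particular
  \<open>scaleR 0 ` A = {0}\<close> for nonempty \<open>A\<close>.
\<close>

definition nontrivial_convex_cone :: "'b::real_vector set \<Rightarrow> bool" where
  "nontrivial_convex_cone K \<longleftrightarrow> convex_cone K \<and> K \<noteq> {0} \<and> K \<noteq> UNIV"

text \<open>The library's \<open>convex_cone\<close> asks for a nonempty convex set closed under nonnegative
  scaling; this is the same as a nonempty set with \<open>\<alpha>K \<subseteq> K\<close> for \<open>\<alpha> \<ge> 0\<close> and \<open>K + K \<subseteq> K\<close>.\<close>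

lemma nontrivial_convex_cone_iff:
  "nontrivial_convex_cone K \<longleftrightarrow>
     K \<noteq> {} \<and> (\<forall>\<alpha>\<ge>0. scaleR \<alpha> ` K \<subseteq> K) \<and> K + K \<subseteq> K \<and> K \<noteq> {0} \<and> K \<noteq> UNIV"
  (is "?L \<longleftrightarrow> ?R")
proof
  assume ?L
  then show ?R
    unfolding nontrivial_convex_cone_def convex_cone_iff by (auto elim!: set_plus_elim)
next
  assume R: ?R
  have scale: "scaleR c x \<in> K" if "x \<in> K" "0 \<le> c" for x c
    using R that by blast
  obtain x where "x \<in> K"
    using R by blast
  then have "0 \<in> K"
    using scale[of x 0] by simp
  moreover have "x + y \<in> K" if "x \<in> K" "y \<in> K" for x y
    using R set_plus_intro[OF that] by blast
  ultimately show ?L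
    using R scale unfolding nontrivial_convex_cone_def convex_cone_iff by simp
qed

definition cone_convex :: "'b::real_vector set \<Rightarrow> 'b set \<Rightarrow> bool" where
  "cone_convex K H \<longleftrightarrow> convex (H + K)"

definition vcl :: "'b::real_vector set \<Rightarrow> 'b set" where
  "vcl A = {y. \<exists>v. \<exists>t :: nat \<Rightarrow> real.
      (\<forall>n. 0 \<le> t n) \<and> t \<longlonglongrightarrow> 0 \<and> (\<forall>n. y + t n *\<^sub>R v \<in> A)}"

definition vcl_dir :: "'b::real_vector \<Rightarrow> 'b set \<Rightarrow> 'b set" where
  "vcl_dir v0 A = {y. \<exists>t :: nat \<Rightarrow> real.
      (\<forall>n. 0 \<le> t n) \<and> t \<longlonglongrightarrow> 0 \<and> (\<forall>n. y + t n *\<^sub>R v0 \<in> A)}"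

text \<open>A value \<open>f x\<close> of a set-valued map may be empty; the empty set is \<open>v0\<close>-closed under this
  definition.\<close>

definition dir_closed :: "'b::real_vector \<Rightarrow> 'b set \<Rightarrow> bool" where
  "dir_closed v0 A \<longleftrightarrow> A = vcl_dir v0 A"

definition lower_complete :: "('a::metric_space \<Rightarrow> 'b::real_vector set) \<Rightarrow> 'b set \<Rightarrow> bool" where
  "lower_complete f K \<longleftrightarrow>
     (\<forall>x :: nat \<Rightarrow> 'a. Cauchy x \<and> (\<forall>n. f (x n) \<subseteq> f (x (Suc n)) + K) \<longrightarrow> (\<exists>z. x \<longlonglongrightarrow> z))"

definition seq_lower_monotone :: "'b set \<Rightarrow> ('a::metric_space \<Rightarrow> 'b::real_vector set) \<Rightarrow> bool" where
  "seq_lower_monotone K f \<longleftrightarrow>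
     (\<forall>(x :: nat \<Rightarrow> 'a) z. x \<longlonglongrightarrow> z \<and> (\<forall>n. f (x n) \<subseteq> f (x (Suc n)) + K)
        \<longrightarrow> (\<forall>n. f (x n) \<subseteq> f z + K))"

definition has_dir_closed_values ::
    "'b set \<Rightarrow> 'b set \<Rightarrow> 'b \<Rightarrow> ('a \<Rightarrow> 'b::real_vector set) \<Rightarrow> bool" where
  "has_dir_closed_values K H v0 f \<longleftrightarrow>
     (\<forall>x. \<forall>\<alpha>>0. dir_closed v0 (f x + scaleR \<alpha> ` H + K))"

end

theory Submission
  imports Defs
begin

text \<open>
  Put \<open>c = eps / lam\<close> and say that \<open>y\<close> is below \<open>x\<close> when
  \<open>f x \<subseteq> f y + c d(x, y) H + K\<close>.  Since \<open>H + K\<close> is convex and \<open>H \<subseteq> K\<close>, the sets \<open>t H + K\<close> add up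
  like their parameters and shrink as \<open>t\<close> grows, so the triangle inequality makes this relation a
  preorder.  The assertion about \<open>xbar\<close> is that it lies below \<open>x0\<close>, that nothing but
  \<open>xbar\<close> itself lies below \<open>xbar\<close>, and that it is close to \<open>x0\<close>.

  The non-inclusion hypothesis scalarises the problem: it provides one point \<open>y0 \<in> f x0\<close> outside
  \<open>f z + eps H + K\<close> for every \<open>z\<close>.  Let \<open>\<phi> z\<close> be the supremum of the \<open>t \<ge> 0\<close> with
  \<open>y0 \<in> f z + t H + K\<close>.  Below \<open>x0\<close> it takes values in \<open>[0, eps]\<close>, and moving from \<open>x\<close> down to
  \<open>y\<close> raises it by at least \<open>c d(x, y)\<close>.  Hence \<open>c d(x0, y) \<le> eps\<close> for every \<open>y\<close> below \<open>x0\<close>, which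
  is the distance bound, and a descending sequence that nearly maximises \<open>\<phi>\<close> at each step is
  Cauchy, with limit the required minimal point (lemma \<open>minimal_point_of_descent\<close>).

  What remains is that the limit of a descending sequence lies below all its terms (lemma
  \<open>descends_limit\<close>).  Monotonicity along the sequence gives \<open>f (x n) \<subseteq> f z + c d(x n, x m) H + K\<close>
  for all \<open>m \<ge> n\<close>, and closedness in the direction \<open>v0\<close> lets \<open>m\<close> tend to infinity, because adding
  a vanishing multiple of \<open>v0 \<in> H + K\<close> makes up for the difference between \<open>d(x n, x m)\<close> and
  \<open>d(x n, z)\<close>.
\<close>

section \<open>Minimal points of a preorder on a metric space\<close>

text \<open>
  This is the scalar core of Ekeland's principle.  Replacing \<open>x\<close> by a point below it where \<open>\<phi>\<close> is
  within \<open>2^-n\<close> of its supremum leaves so little room for further ascent that everything still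
  below lies within \<open>2^-n / c\<close>; so these sets of lower points shrink to the limit.
\<close>

lemma minimal_point_of_descent:
  fixes R :: "'a::metric_space \<Rightarrow> 'a \<Rightarrow> bool" and \<phi> :: "'a \<Rightarrow> real"
  assumes refl: "\<And>x. R x x"
    and trans: "\<And>x y z. R x y \<Longrightarrow> R y z \<Longrightarrow> R x z"
    and bounded: "\<And>x. R x0 x \<Longrightarrow> \<phi> x \<le> B"
    and c: "c > 0"
    and ascent: "\<And>x y. R x0 x \<Longrightarrow> R x y \<Longrightarrow> \<phi> x + c * dist x y \<le> \<phi> y"
    and limits: "\<And>x :: nat \<Rightarrow> 'a. Cauchy x \<Longrightarrow> (\<And>m n. m \<le> n \<Longrightarrow> R (x m) (x n)) \<Longrightarrow>
                   \<exists>z. x \<longlonglongrightarrow> z \<and> (\<forall>n. R (x n) z)"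
  shows "\<exists>z. R x0 z \<and> (\<forall>x. R z x \<longrightarrow> x = z)"
proof -
  have step: "\<exists>y. R x0 y \<and> R x y \<and> (\<forall>z. R y z \<longrightarrow> \<phi> z \<le> \<phi> y + (1/2)^n)"
    if x: "R x0 x" for x and n :: nat
  proof -
    let ?V = "\<phi> ` {z. R x z}"
    have bdd: "bdd_above ?V"
      using bounded trans[OF x] by (auto intro!: bdd_aboveI)
    moreover have "?V \<noteq> {}"
      using refl by blast
    moreover have "Sup ?V - (1/2)^n < Sup ?V"
      by simp
    ultimately obtain y where y: "R x y" "Sup ?V - (1/2)^n < \<phi> y"
      using less_cSup_iff[of ?V "Sup ?V - (1/2)^n"] by auto
    have "\<phi> z \<le> \<phi> y + (1/2)^n" if "R y z" for z
    proof -
      have "\<phi> z \<le> Sup ?V"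
        using cSup_upper[OF _ bdd] trans[OF y(1) that] by blast
      then show ?thesis
        using y(2) by linarith
    qed
    then show ?thesis
      using trans[OF x y(1)] y(1) by blast
  qed
  obtain x :: "nat \<Rightarrow> 'a" where below: "\<And>n. R x0 (x n)" and desc: "\<And>n. R (x n) (x (Suc n))"
    and near: "\<And>n z. R (x (Suc n)) z \<Longrightarrow> \<phi> z \<le> \<phi> (x (Suc n)) + (1/2)^n"
    using dependent_nat_choice[of "\<lambda>_ y. R x0 y"
        "\<lambda>n x y. R x y \<and> (\<forall>z. R y z \<longrightarrow> \<phi> z \<le> \<phi> y + (1/2)^n)"] refl step by metis
  have mono: "R (x m) (x n)" if "m \<le> n" for m n
    using that by (induction n rule: dec_induct) (use refl trans desc in blast)+
  have close: "dist (x (Suc n)) z \<le> (1/2)^n / c" if "R (x (Suc n)) z" for n z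
  proof -
    have "c * dist (x (Suc n)) z \<le> (1/2)^n"
      using ascent[OF below that] near[OF that] by linarith
    then show ?thesis
      using c by (simp add: pos_le_divide_eq mult.commute)
  qed
  have radii: "(\<lambda>n. (1/2)^n / c) \<longlonglongrightarrow> 0"
    using tendsto_divide[OF LIMSEQ_power_zero[of "1/2::real"] tendsto_const[of c]] c by simp
  have "Cauchy x"
    unfolding Cauchy_altdef2
  proof (intro allI impI)
    fix e :: real assume "e > 0"
    then have "\<forall>\<^sub>F n in sequentially. (1/2)^n / c < e"
      using order_tendstoD(2)[OF radii] by blast
    then obtain N :: nat where "(1/2)^N / c < e"
      using eventually_sequentially by auto
    then have "\<forall>n\<ge>Suc N. dist (x n) (x (Suc N)) < e"
      using close mono by (metis dist_commute le_less_trans)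
    then show "\<exists>N. \<forall>n\<ge>N. dist (x n) (x N) < e"
      by blast
  qed
  then obtain z where lim: "x \<longlonglongrightarrow> z" and z: "\<And>n. R (x n) z"
    using limits mono by blast
  have "y = z" if "R z y" for y
  proof -
    have "dist (x (Suc n)) y \<le> (1/2)^n / c" for n
      using close trans[OF z that] by blast
    then have "(\<lambda>n. dist (x (Suc n)) y) \<longlonglongrightarrow> 0"
      using tendsto_sandwich[OF _ _ tendsto_const radii] by simp
    then have "(\<lambda>n. x (Suc n)) \<longlonglongrightarrow> y"
      using tendsto_dist_iff by blast
    then show ?thesis
      using LIMSEQ_unique LIMSEQ_Suc[OF lim] by blast
  qed
  then show ?thesis
    using trans[OF below z] by blast
qed

section \<open>Dilations of a cone-convex set\<close>

definition dilate_plus :: "'b::real_vector set \<Rightarrow> 'b set \<Rightarrow> real \<Rightarrow> 'b set" where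
  "dilate_plus H K t = scaleR t ` H + K"

lemma dilate_plusI: "h \<in> H \<Longrightarrow> k \<in> K \<Longrightarrow> y = t *\<^sub>R h + k \<Longrightarrow> y \<in> dilate_plus H K t"
  unfolding dilate_plus_def by blast

lemma dilate_plusE:
  assumes "y \<in> dilate_plus H K t"
  obtains h k where "h \<in> H" "k \<in> K" "y = t *\<^sub>R h + k"
  using assms unfolding dilate_plus_def by (auto elim!: set_plus_elim)

lemma dilate_plus_zero: "H \<noteq> {} \<Longrightarrow> dilate_plus H K 0 = K"
  by (auto elim!: dilate_plusE intro!: dilate_plusI)

lemma scaleR_mem_dilate_plus:
  assumes K: "convex_cone K" and v: "v \<in> H + K" and t: "0 \<le> t"
  shows "t *\<^sub>R v \<in> dilate_plus H K t"
proof -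
  obtain h k where hk: "h \<in> H" "k \<in> K" "v = h + k"
    using v by (rule set_plus_elim)
  then have "t *\<^sub>R k \<in> K" "t *\<^sub>R v = t *\<^sub>R h + t *\<^sub>R k"
    using K t by (auto simp: convex_cone_iff scaleR_add_right)
  then show ?thesis
    using hk(1) by (blast intro: dilate_plusI)
qed

lemma dilate_plus_absorb: "convex_cone K \<Longrightarrow> y \<in> dilate_plus H K t \<Longrightarrow> k \<in> K \<Longrightarrow> y + k \<in> dilate_plus H K t"
  by (elim dilate_plusE, rule dilate_plusI) (auto simp: convex_cone_iff add.assoc)

lemma dilate_plus_antimono:
  assumes K: "convex_cone K" and HK: "H \<subseteq> K" and st: "s \<le> t"
  shows "dilate_plus H K t \<subseteq> dilate_plus H K s"
proof
  fix y assume "y \<in> dilate_plus H K t"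
  then obtain h k where hk: "h \<in> H" "k \<in> K" "y = t *\<^sub>R h + k"
    by (rule dilate_plusE)
  have "(t - s) *\<^sub>R h + k \<in> K"
    using K HK st hk(1,2) unfolding convex_cone_iff by auto
  moreover have "y = s *\<^sub>R h + ((t - s) *\<^sub>R h + k)"
    using hk(3) by (simp add: algebra_simps)
  ultimately show "y \<in> dilate_plus H K s"
    using hk(1) by (blast intro: dilate_plusI)
qed

text \<open>
  This rests on the convexity of \<open>H + K\<close>: \<open>s h + t h'\<close> is \<open>s + t\<close> times a convex
  combination of \<open>h\<close> and \<open>h'\<close>, which lies in \<open>H + K\<close>, although perhaps not in \<open>H\<close>.
\<close>

lemma dilate_plus_add:
  assumes K: "convex_cone K" and conv: "cone_convex K H"
    and s: "0 \<le> s" and t: "0 \<le> t"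
    and a: "a \<in> dilate_plus H K s" and b: "b \<in> dilate_plus H K t"
  shows "a + b \<in> dilate_plus H K (s + t)"
proof -
  obtain h k where hk: "h \<in> H" "k \<in> K" "a = s *\<^sub>R h + k"
    using a by (rule dilate_plusE)
  obtain h' k' where hk': "h' \<in> H" "k' \<in> K" "b = t *\<^sub>R h' + k'"
    using b by (rule dilate_plusE)
  have kk: "k + k' \<in> K"
    using K hk(2) hk'(2) by (auto simp: convex_cone_iff)
  show ?thesis
  proof (cases "s + t = 0")
    case True
    then have "s = 0" "t = 0"
      using s t by auto
    then show ?thesis
      using hk hk' kk by (auto intro: dilate_plusI)
  next
    case False
    then have pos: "s + t > 0"
      using s t by linarith
    have "0 \<in> K"
      using K by (simp add: convex_cone_iff)
    then have "h \<in> H + K" "h' \<in> H + K"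
      using hk(1) hk'(1) set_plus_intro[of _ H 0 K] by auto
    then have "(s / (s + t)) *\<^sub>R h + (t / (s + t)) *\<^sub>R h' \<in> H + K"
      using conv pos s t unfolding cone_convex_def
      by (intro convexD) (auto simp: add_divide_distrib[symmetric])
    from scaleR_mem_dilate_plus[OF K this, of "s + t"]
    have "s *\<^sub>R h + t *\<^sub>R h' \<in> dilate_plus H K (s + t)"
      using pos by (simp add: scaleR_add_right)
    from dilate_plus_absorb[OF K this kk] show ?thesis
      unfolding hk(3) hk'(3) by (simp add: algebra_simps)
  qed
qed

section \<open>The preorder of a set-valued map\<close>

definition descends ::
    "('a::metric_space \<Rightarrow> 'b::real_vector set) \<Rightarrow> 'b set \<Rightarrow> 'b set \<Rightarrow> real \<Rightarrow> 'a \<Rightarrow> 'a \<Rightarrow> bool" where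
  "descends f H K c x y \<longleftrightarrow> f x \<subseteq> f y + dilate_plus H K (c * dist x y)"

text \<open>
  The first summand of a point of \<open>f x + (t H + K)\<close> is pushed down to \<open>f y\<close>, and the two parameters
  add up.  Transitivity (with \<open>p \<in> f x\<close> already pushed down once) and the growth of the scalar
  function \<open>\<phi>\<close> (with \<open>p = y0\<close>) are both instances.
\<close>

lemma descends_push:
  assumes K: "convex_cone K" and conv: "cone_convex K H" and c: "0 \<le> c" and t: "0 \<le> t"
    and xy: "descends f H K c x y" and p: "p \<in> f x + dilate_plus H K t"
  shows "p \<in> f y + dilate_plus H K (t + c * dist x y)"
proof -
  obtain a b where ab: "a \<in> f x" "b \<in> dilate_plus H K t" "p = a + b"
    using p by (rule set_plus_elim)
  have "a \<in> f y + dilate_plus H K (c * dist x y)"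
    using ab(1) xy unfolding descends_def by blast
  then obtain a' b' where ab': "a' \<in> f y" "b' \<in> dilate_plus H K (c * dist x y)" "a = a' + b'"
    by (rule set_plus_elim)
  have "b + b' \<in> dilate_plus H K (t + c * dist x y)"
    using dilate_plus_add[OF K conv t _ ab(2) ab'(2)] c by simp
  moreover have "p = a' + (b + b')"
    using ab(3) ab'(3) by (simp add: algebra_simps)
  ultimately show ?thesis
    using ab'(1) by blast
qed

lemma descends_refl: "convex_cone K \<Longrightarrow> H \<noteq> {} \<Longrightarrow> descends f H K c x x"
  using set_plus_intro[of _ "f x" 0 K]
  by (auto simp: descends_def dilate_plus_zero convex_cone_iff)

lemma descends_trans:
  assumes K: "convex_cone K" and HK: "H \<subseteq> K" and conv: "cone_convex K H" and c: "0 \<le> c"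
    and xy: "descends f H K c x y" and yz: "descends f H K c y z"
  shows "descends f H K c x z"
proof -
  have "c * dist x z \<le> c * dist x y + c * dist y z"
    using c dist_triangle[of x z y] by (metis distrib_left mult_left_mono)
  note anti = dilate_plus_antimono[OF K HK this]
  have "p \<in> f z + dilate_plus H K (c * dist x z)" if "p \<in> f x" for p
  proof -
    have "p \<in> f y + dilate_plus H K (c * dist x y)"
      using that xy unfolding descends_def by blast
    from descends_push[OF K conv c _ yz this]
    have "p \<in> f z + dilate_plus H K (c * dist x y + c * dist y z)"
      using c by simp
    then show ?thesis
      using set_plus_mono2[OF subset_refl anti] by blast
  qed
  then show ?thesis
    unfolding descends_def by blast
qed

lemma descends_imp_subset_plus_cone:
  assumes K: "convex_cone K" and HK: "H \<subseteq> K" "H \<noteq> {}" and c: "0 \<le> c"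
    and xy: "descends f H K c x y"
  shows "f x \<subseteq> f y + K"
proof -
  have "dilate_plus H K (c * dist x y) \<subseteq> K"
    using dilate_plus_antimono[OF K HK(1), of 0] dilate_plus_zero[OF HK(2), of K] c by simp
  then show ?thesis
    using xy set_plus_mono2[OF subset_refl] unfolding descends_def by blast
qed

text \<open>
  The parameters \<open>c d(x n, x m)\<close> converge to \<open>c d(x n, z)\<close> but may stay below it.  The shortfall
  \<open>t m\<close> tends to \<open>0\<close> and is compensated by adding \<open>t m v0\<close>, which is the kind of
  perturbation that closedness in the direction \<open>v0\<close> can remove.
\<close>

lemma descends_limit:
  fixes x :: "nat \<Rightarrow> 'a::metric_space"
  assumes K: "convex_cone K" and HK: "H \<subseteq> K" "H \<noteq> {}" and conv: "cone_convex K H"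
    and c: "0 < c" and slm: "seq_lower_monotone K f"
    and v0: "v0 \<in> H + K" and closed: "has_dir_closed_values K H v0 f"
    and lim: "x \<longlonglongrightarrow> z" and desc: "\<And>m n. m \<le> n \<Longrightarrow> descends f H K c (x m) (x n)"
  shows "descends f H K c (x n) z"
proof -
  have to_z: "f (x m) \<subseteq> f z + K" for m
    using slm lim desc[THEN descends_imp_subset_plus_cone[OF K HK less_imp_le[OF c]]]
    unfolding seq_lower_monotone_def by simp
  show ?thesis
  proof (cases "x n = z")
    case True
    then show ?thesis
      using descends_refl[OF K HK(2)] by simp
  next
    case False
    define r where "r = c * dist (x n) z"
    define s where "s m = c * dist (x n) (x (n + m))" for m
    define t where "t m = max 0 (r - s m)" for m
    have "r > 0"
      using False c by (simp add: r_def)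
    have s_nonneg: "0 \<le> s m" for m
      using c by (simp add: s_def)
    have "(\<lambda>m. x (n + m)) \<longlonglongrightarrow> z"
      using LIMSEQ_ignore_initial_segment[OF lim, of n] by (simp add: add.commute)
    then have "s \<longlonglongrightarrow> r"
      unfolding s_def r_def by (intro tendsto_intros)
    then have "t \<longlonglongrightarrow> max 0 (r - r)"
      unfolding t_def by (intro tendsto_intros)
    then have t_lim: "t \<longlonglongrightarrow> 0"
      by simp
    have t_nonneg: "0 \<le> t m" for m
      by (simp add: t_def)
    have "p \<in> f z + dilate_plus H K r" if p: "p \<in> f (x n)" for p
    proof -
      have "p + t m *\<^sub>R v0 \<in> f z + dilate_plus H K r" for m
      proof -
        have "p \<in> f (x (n + m)) + dilate_plus H K (s m)"
          using p desc[of n "n + m"] unfolding descends_def s_def by auto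
        then obtain a b where ab: "a \<in> f (x (n + m))" "b \<in> dilate_plus H K (s m)" "p = a + b"
          by (rule set_plus_elim)
        have "a \<in> f z + K"
          using ab(1) to_z by blast
        then obtain a' k where ak: "a' \<in> f z" "k \<in> K" "a = a' + k"
          by (rule set_plus_elim)
        have "b + t m *\<^sub>R v0 \<in> dilate_plus H K (s m + t m)"
          by (intro dilate_plus_add scaleR_mem_dilate_plus K conv s_nonneg t_nonneg ab(2) v0)
        from dilate_plus_absorb[OF K this ak(2)]
        have "b + t m *\<^sub>R v0 + k \<in> dilate_plus H K r"
          using dilate_plus_antimono[OF K HK(1), of r "s m + t m"] unfolding t_def by fastforce
        moreover have "p + t m *\<^sub>R v0 = a' + (b + t m *\<^sub>R v0 + k)"
          using ab(3) ak(3) by (simp add: algebra_simps)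
        ultimately show ?thesis
          using ak(1) by (metis set_plus_intro)
      qed
      then have "p \<in> vcl_dir v0 (f z + dilate_plus H K r)"
        unfolding vcl_dir_def using t_nonneg t_lim by blast
      then show ?thesis
        using closed \<open>r > 0\<close>
        unfolding has_dir_closed_values_def dir_closed_def dilate_plus_def
        by (metis add.assoc)
    qed
    then show ?thesis
      unfolding descends_def r_def by blast
  qed
qed

section \<open>The variational principle\<close>

theorem corollary5p7:
  fixes f :: "'a::metric_space \<Rightarrow> 'b::real_vector set"
    and K H :: "'b set"
    and x0 :: 'a
    and v0 :: 'b
    and eps lam :: real
  assumes "nontrivial_convex_cone K"
    and "H \<subseteq> K" and "H \<noteq> {}" and "cone_convex K H"
    and "0 \<notin> vcl (H + K)"
    and "eps > 0" and "lam > 0"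
    and "lower_complete f K"
    and "\<not> f x0 \<subseteq> (\<Union>x. f x) + scaleR eps ` H + K"
    and "seq_lower_monotone K f"
    and "v0 \<in> H + K" and "has_dir_closed_values K H v0 f"
  shows "\<exists>xbar.
      f x0 \<subseteq> f xbar + scaleR ((eps / lam) * dist x0 xbar) ` H + K \<and>
      (\<forall>x. x \<noteq> xbar \<longrightarrow> \<not> f xbar \<subseteq> f x + scaleR ((eps / lam) * dist xbar x) ` H + K) \<and>
      dist x0 xbar \<le> lam"
proof -
  define c where "c = eps / lam"
  have c: "c > 0" and eps: "c * lam = eps"
    using assms(6,7) by (simp_all add: c_def)
  have K: "convex_cone K"
    using assms(1) by (simp add: nontrivial_convex_cone_def)
  note HK = assms(2,3) and conv = assms(4)
  obtain y0 where y0: "y0 \<in> f x0" and out: "\<And>z. y0 \<notin> f z + dilate_plus H K eps"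
  proof -
    obtain y where y: "y \<in> f x0" "y \<notin> (\<Union>x. f x) + scaleR eps ` H + K"
      using assms(9) by blast
    have "f z + dilate_plus H K eps \<subseteq> (\<Union>x. f x) + scaleR eps ` H + K" for z
      unfolding dilate_plus_def add.assoc by (rule set_plus_mono2) auto
    then show thesis
      using that y by blast
  qed
  let ?R = "descends f H K c"
  \<comment> \<open>\<open>Sup (T z)\<close> is the scalar function \<open>\<phi> z\<close>; \<open>T z\<close> is nonempty only when \<open>y0 \<in> f z + K\<close>,
    which holds at the points below \<open>x0\<close>.\<close>
  define T where "T z = {t. 0 \<le> t \<and> y0 \<in> f z + dilate_plus H K t}" for z
  have T_le: "t \<le> eps" if "t \<in> T z" for t z
  proof (rule ccontr)
    assume "\<not> t \<le> eps"
    then have "f z + dilate_plus H K t \<subseteq> f z + dilate_plus H K eps"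
      by (intro set_plus_mono2 dilate_plus_antimono[OF K HK(1)]) auto
    then show False
      using that out unfolding T_def by blast
  qed
  have T_bdd: "bdd_above (T z)" for z
    using T_le by (rule bdd_aboveI)
  have T_shift: "t + c * dist x y \<in> T y" if "?R x y" "t \<in> T x" for x y t
    using descends_push[OF K conv less_imp_le[OF c] _ that(1)] that(2) c by (simp add: T_def)
  have "0 \<in> T x0"
    using y0 descends_refl[OF K HK(2), of f c x0] by (auto simp: T_def descends_def)
  then have T_start: "c * dist x0 x \<in> T x" if "?R x0 x" for x
    using T_shift[OF that] by fastforce
  have bound: "Sup (T x) \<le> eps" if "?R x0 x" for x
    using T_start[OF that] T_le by (intro cSup_least) auto
  have ascent: "Sup (T x) + c * dist x y \<le> Sup (T y)" if "?R x0 x" "?R x y" for x y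
  proof -
    have "Sup (T x) \<le> Sup (T y) - c * dist x y"
    proof (rule cSup_least)
      show "T x \<noteq> {}"
        using T_start[OF that(1)] by blast
      show "t \<le> Sup (T y) - c * dist x y" if "t \<in> T x" for t
        using cSup_upper[OF T_shift[OF \<open>?R x y\<close> that] T_bdd] by linarith
    qed
    then show ?thesis
      by linarith
  qed
  have limits: "\<exists>z. x \<longlonglongrightarrow> z \<and> (\<forall>n. ?R (x n) z)"
    if "Cauchy x" and desc: "\<And>m n. m \<le> n \<Longrightarrow> ?R (x m) (x n)" for x :: "nat \<Rightarrow> 'a"
  proof -
    have "f (x n) \<subseteq> f (x (Suc n)) + K" for n
      using desc[THEN descends_imp_subset_plus_cone[OF K HK less_imp_le[OF c]]] by simp
    then obtain z where z: "x \<longlonglongrightarrow> z"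
      using assms(8) \<open>Cauchy x\<close> unfolding lower_complete_def by blast
    then show ?thesis
      using descends_limit[OF K HK conv c assms(10-12) z desc] by blast
  qed
  obtain xbar where below: "?R x0 xbar" and minimal: "\<And>x. ?R xbar x \<Longrightarrow> x = xbar"
  proof -
    have "\<exists>z. ?R x0 z \<and> (\<forall>x. ?R z x \<longrightarrow> x = z)"
    proof (rule minimal_point_of_descent[where \<phi> = "\<lambda>x. Sup (T x)"])
      show "?R x x" for x
        by (rule descends_refl[OF K HK(2)])
      show "?R x z" if "?R x y" "?R y z" for x y z
        by (rule descends_trans[OF K HK(1) conv less_imp_le[OF c] that])
    qed (fact bound c ascent limits)+
    then show thesis
      using that by blast
  qed
  have "c * dist x0 xbar \<le> c * lam"
    using T_le[OF T_start[OF below]] eps by simp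
  then have "dist x0 xbar \<le> lam"
    using c by simp
  moreover have R_iff: "?R x y \<longleftrightarrow> f x \<subseteq> f y + scaleR ((eps / lam) * dist x y) ` H + K" for x y
    by (simp add: descends_def dilate_plus_def c_def add.assoc)
  ultimately show ?thesis
    using below minimal unfolding R_iff by blast
qed

end
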